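(* Let $p$ be prime. There exists $L\in GL_2(\mathbb{F}_p)$ such that for every pair $a_1,a_2$ of semi-magic $p\times p$ integer arrays, with line sums $\gamma(a_1),\gamma(a_2)$, the two diagonal identities $$\sum_{v\in\mathbb{F}_p^2}\prod_{i=1}^{2}a_i\big((Lv)_i,\,v_i\big)=\gamma(a_1)\gamma(a_2)\quad\text{and}\quad\sum_{v\in\mathbb{F}_p^2}\prod_{i=1}^{2}a_i\big((Lv)_i,\,p-1-v_i\big)=\gamma(a_1)\gamma(a_2)$$ hold, if and only if $p\le3$.
   Context: A $p\times p$ integer array is a function $a:\mathbb{F}_p\times\mathbb{F}_p\to\mathbb{Z}$, with $\mathbb{F}_p$ identified with $\{0,\dots,p-1\}$. It is semi-magic with line sum $\gamma(a)$ if all row sums $\sum_y a(x,y)$ and all column sums $\sum_x a(x,y)$ equal $\gamma(a)$. *)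

theory Defs
  imports
    "HOL-Analysis.Analysis"
    "Berlekamp_Zassenhaus.Finite_Field"
begin

text \<open>
  The field with \<open>p\<close> elements is the type \<open>'p mod_ring\<close> with \<open>'p :: prime_card\<close>, where
  \<open>p = CARD('p)\<close>; its elements are represented by the integers in \<open>{0..<p}\<close>
  through \<open>to_int_mod_ring\<close> and \<open>of_int_mod_ring\<close>.
\<close>

type_synonym 'p int_array = "'p mod_ring \<Rightarrow> 'p mod_ring \<Rightarrow> int"

definition semi_magic :: "'p::prime_card int_array \<Rightarrow> int \<Rightarrow> bool" where
  "semi_magic a \<gamma> \<longleftrightarrow> (\<forall>x. (\<Sum>y\<in>UNIV. a x y) = \<gamma>) \<and> (\<forall>y. (\<Sum>x\<in>UNIV. a x y) = \<gamma>)"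

text \<open>
  The map \<open>y \<mapsto> p - 1 - y\<close>, computed on the representatives in \<open>{0..<p}\<close>, which it preserves.
\<close>

definition reflect :: "'p::prime_card mod_ring \<Rightarrow> 'p mod_ring" where
  "reflect y = of_int_mod_ring (int CARD('p) - 1 - to_int_mod_ring y)"

end

theory Submission
  imports Defs
begin

text \<open>
  Since \<open>p - 1 - y = -1 - y\<close> in the field, reflecting the columns of a semi-magic array gives a
  semi-magic array, so only the first identity matters. Write \<open>L = (a b; c d)\<close>. By Fourier
  analysis the first identity holds iff no \<open>t \<noteq> 0\<close> satisfies both \<open>a + c t \<noteq> 0\<close> and
  \<open>b + d t \<noteq> 0\<close>. Each condition excludes at most one \<open>t\<close>, so \<open>p > 3\<close> leaves such a \<open>t\<close>, and then
  the indicators of the lines \<open>s = (a + c t) x\<close> and \<open>t s = (b + d t) y\<close> are semi-magic arrays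
  with line sum 1 whose diagonal sum exceeds 1. For \<open>p \<le> 3\<close> one can choose \<open>L\<close> so that
  all \<open>t \<noteq> 0\<close> are excluded.
\<close>

lemma sum_vec_2:
  fixes h :: "'a::finite \<Rightarrow> 'a \<Rightarrow> 'b::comm_monoid_add"
  shows "(\<Sum>v\<in>(UNIV :: ('a ^ 2) set). h (v $ 1) (v $ 2)) = (\<Sum>x\<in>UNIV. \<Sum>y\<in>UNIV. h x y)"
proof -
  have "(\<Sum>x\<in>UNIV. \<Sum>y\<in>UNIV. h x y) = (\<Sum>(x, y)\<in>UNIV. h x y)"
    by (simp add: sum.cartesian_product)
  also have "\<dots> = (\<Sum>v\<in>(UNIV :: ('a ^ 2) set). h (v $ 1) (v $ 2))"
    by (rule sum.reindex_bij_witness[where j = "\<lambda>(x, y). \<chi> i. if i = 1 then x else y"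
          and i = "\<lambda>v. (v $ 1, v $ 2)"])
      (auto simp: vec_eq_iff forall_2)
  finally show ?thesis by simp
qed

text \<open>\<open>of_int_mod_ring\<close> is the ring homomorphism from the integers, and it kills
  p.\<close>

lemma reflect_eq: "reflect y = - 1 - (y :: 'p::prime_card mod_ring)"
proof -
  have "reflect y = (of_int (int CARD('p) - 1 - to_int_mod_ring y) :: 'p mod_ring)"
    by (simp add: reflect_def of_int_of_int_mod_ring)
  also have "\<dots> = - 1 - y"
    by (simp add: of_int_of_int_mod_ring[THEN fun_cong, of "to_int_mod_ring y"])
  finally show ?thesis .
qed

text \<open>\<open>reflect\<close> is an involution, so each row is merely permuted, and every
  column of the new array is a column of the old one.\<close>

lemma semi_magic_reflect:
  assumes "semi_magic a \<gamma>"
  shows "semi_magic (\<lambda>x y. a x (reflect y)) \<gamma>"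
proof -
  have "(\<Sum>y\<in>UNIV. a x (reflect y)) = (\<Sum>y\<in>UNIV. a x y)" for x
    by (rule sum.reindex_bij_witness[where j = reflect and i = reflect]) (auto simp: reflect_eq)
  with assms show ?thesis by (simp add: semi_magic_def)
qed

text \<open>Such a line is the graph of a bijection, so its indicator is a permutation
  matrix.\<close>

lemma semi_magic_line:
  fixes k l :: "'p::prime_card mod_ring"
  assumes "k \<noteq> 0" "l \<noteq> 0"
  shows "semi_magic (\<lambda>x y. of_bool (k * x = l * y)) 1"
proof -
  have "{y. k * x = l * y} = {k * x / l}" "{x. k * x = l * y} = {l * y / k}" for x y
    using assms by (auto simp: field_simps)
  then show ?thesis by (simp add: semi_magic_def flip: Collect_conj_eq)
qed

text \<open>Coordinates and two separate arrays replace vectors and families over the type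
  \<open>2\<close>, ready for entrywise evaluation when p is 2 or 3.\<close>

definition diagonal_identity :: "'p::prime_card mod_ring ^ 2 ^ 2 \<Rightarrow> bool" where
  "diagonal_identity L \<longleftrightarrow> (\<forall>a b \<gamma> \<delta>. semi_magic a \<gamma> \<longrightarrow> semi_magic b \<delta> \<longrightarrow>
     (\<Sum>x\<in>UNIV. \<Sum>y\<in>UNIV. a (L $ 1 $ 1 * x + L $ 1 $ 2 * y) x * b (L $ 2 $ 1 * x + L $ 2 $ 2 * y) y)
       = \<gamma> * \<delta>)"

lemma diagonal_sum_eq:
  fixes L :: "'p::prime_card mod_ring ^ 2 ^ 2" and a :: "2 \<Rightarrow> 'p int_array"
  shows "(\<Sum>v\<in>UNIV. \<Prod>i\<in>UNIV. a i ((L *v v) $ i) (v $ i)) =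
    (\<Sum>x\<in>UNIV. \<Sum>y\<in>UNIV. a 1 (L $ 1 $ 1 * x + L $ 1 $ 2 * y) x * a 2 (L $ 2 $ 1 * x + L $ 2 $ 2 * y) y)"
  by (simp add: UNIV_2 matrix_vector_mult_def flip: sum_vec_2)

lemma diagonal_identity_iff:
  fixes L :: "'p::prime_card mod_ring ^ 2 ^ 2"
  shows "(\<forall>(a :: 2 \<Rightarrow> 'p int_array) (\<gamma> :: 2 \<Rightarrow> int).
              (\<forall>i. semi_magic (a i) (\<gamma> i)) \<longrightarrow>
                (\<Sum>v\<in>UNIV. \<Prod>i\<in>UNIV. a i ((L *v v) $ i) (v $ i)) = \<gamma> 1 * \<gamma> 2 \<and>
                (\<Sum>v\<in>UNIV. \<Prod>i\<in>UNIV. a i ((L *v v) $ i) (reflect (v $ i))) = \<gamma> 1 * \<gamma> 2)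
         \<longleftrightarrow> diagonal_identity L" (is "?lhs \<longleftrightarrow> _")
proof
  assume lhs: ?lhs
  show "diagonal_identity L"
    unfolding diagonal_identity_def
  proof (intro allI impI)
    fix a b :: "'p int_array" and \<gamma> \<delta>
    assume "semi_magic a \<gamma>" "semi_magic b \<delta>"
    then have "\<forall>i::2. semi_magic (if i = 1 then a else b) (if i = 1 then \<gamma> else \<delta>)"
      by simp
    with lhs[THEN spec, THEN spec, of "\<lambda>i. if i = 1 then a else b" "\<lambda>i. if i = 1 then \<gamma> else \<delta>"]
    show "(\<Sum>x\<in>UNIV. \<Sum>y\<in>UNIV. a (L $ 1 $ 1 * x + L $ 1 $ 2 * y) x * b (L $ 2 $ 1 * x + L $ 2 $ 2 * y) y)
       = \<gamma> * \<delta>"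
      unfolding diagonal_sum_eq[of "\<lambda>i. if i = 1 then a else b"] by simp
  qed
next
  assume L: "diagonal_identity L"
  have *: "(\<Sum>v\<in>UNIV. \<Prod>i\<in>UNIV. a i ((L *v v) $ i) (v $ i)) = \<gamma> 1 * \<gamma> 2"
    if "\<forall>i. semi_magic (a i) (\<gamma> i)" for a :: "2 \<Rightarrow> 'p int_array" and \<gamma>
    using L that unfolding diagonal_sum_eq diagonal_identity_def by blast
  show ?lhs
    using * *[where a = "\<lambda>i x y. a i x (reflect y)" for a] by (simp add: semi_magic_reflect)
qed

lemma diagonal_identity_imp_card_le_3:
  fixes L :: "'p::prime_card mod_ring ^ 2 ^ 2"
  assumes "invertible L" and L: "diagonal_identity L"
  shows "CARD('p) \<le> 3"
proof (rule ccontr)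
  assume "\<not> CARD('p) \<le> 3"
  then have card: "card (UNIV :: 'p mod_ring set) > 3" by simp
  define a b c d where abcd: "a = L $ 1 $ 1" "b = L $ 1 $ 2" "c = L $ 2 $ 1" "d = L $ 2 $ 2"
  have det: "a * d - b * c \<noteq> 0"
    using assms(1) unfolding invertible_det_nz det_2 abcd .
  \<comment> \<open>Since \<open>x / 0 = 0\<close>, a vanishing \<open>c\<close> or \<open>d\<close>
    only repeats the element 0 here; \<open>det\<close> then makes \<open>a\<close> or
    \<open>b\<close>, respectively, nonzero.\<close>
  have "card {0, - a / c, - b / d} \<le> 3"
    by (simp add: card_insert_if)
  with card have "\<not> UNIV \<subseteq> {0, - a / c, - b / d}"
    by (metis leD top.extremum_uniqueI)
  then obtain t where t: "t \<noteq> 0" "t \<noteq> - a / c" "t \<noteq> - b / d" by blast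
  have ac: "a + c * t \<noteq> 0"
    using t(1,2) det by (cases "c = 0") (auto simp: field_simps add_eq_0_iff2)
  have bd: "b + d * t \<noteq> 0"
    using t(1,3) det by (cases "d = 0") (auto simp: field_simps add_eq_0_iff2)
  have "(1::int) = (\<Sum>x\<in>UNIV. \<Sum>y\<in>UNIV. of_bool (1 * (a * x + b * y) = (a + c * t) * x) *
                       of_bool (t * (c * x + d * y) = (b + d * t) * y))"
    using L semi_magic_line[OF one_neq_zero ac] semi_magic_line[OF t(1) bd]
    unfolding diagonal_identity_def abcd[symmetric] by fastforce
  \<comment> \<open>The slopes are chosen so that both line conditions, after cancelling
    \<open>a * x\<close> in one and \<open>d * t * y\<close> in the other, become the same
    homogeneous equation. The product of the indicators is therefore a single indicator.\<close>
  also have "\<dots> = (\<Sum>(x, y)\<in>UNIV. of_bool (b * y = c * t * x))"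
    unfolding UNIV_Times_UNIV[symmetric] sum.cartesian_product[symmetric]
    by (intro sum.cong refl) (auto simp: algebra_simps)
  also have "\<dots> = int (card {(x, y). b * y = c * t * x})"
    by (simp add: case_prod_unfold)
  finally have 1: "card {(x, y). b * y = c * t * x} = 1" by simp
  \<comment> \<open>One homogeneous equation in two unknowns has a nonzero solution:
    \<open>(b, c * t)\<close>, or any point if that vector is zero.\<close>
  have "(0, 0) \<in> {(x, y). b * y = c * t * x}" "(b, c * t) \<in> {(x, y). b * y = c * t * x}" by simp_all
  with 1 have "b = 0 \<and> c * t = 0"
    by (metis card_1_singletonE singletonD prod.inject)
  then have "(1, 1) \<in> {(x, y). b * y = c * t * x}" by simp
  with 1 \<open>(0, 0) \<in> _\<close> show False
    by (metis card_1_singletonE singletonD prod.inject one_neq_zero)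
qed

lemma diagonal_identity_card_2:
  assumes "CARD('p::prime_card) = 2"
  shows "\<exists>L :: 'p mod_ring ^ 2 ^ 2. invertible L \<and> diagonal_identity L"
proof -
  have U: "UNIV = {0, 1 :: 'p mod_ring}"
    by (rule card_subset_eq[symmetric]) (use assms in auto)
  have two: "1 + 1 = (0 :: 'p mod_ring)"
    using of_nat_card_eq_0[where 'a = 'p] by (simp add: assms)
  \<comment> \<open>The only nonzero t is 1, and it is excluded by
    \<open>1 + 1 * t = 0\<close>.\<close>
  define L :: "'p mod_ring ^ 2 ^ 2" where "L = vector [vector [1, 1], vector [1, 0]]"
  have "invertible L"
    by (simp add: invertible_det_nz det_2 L_def)
  moreover have "diagonal_identity L"
    unfolding diagonal_identity_def
  proof (intro allI impI)
    fix a b :: "'p int_array" and \<gamma> \<delta>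
    assume ab: "semi_magic a \<gamma>" "semi_magic b \<delta>"
    \<comment> \<open>One corner and the line sum determine the array, so the claim becomes a
      polynomial identity in two corners and two line sums.\<close>
    have eq: "m 0 1 = \<epsilon> - m 0 0" "m 1 0 = \<epsilon> - m 0 0" "m 1 1 = m 0 0"
      if "semi_magic m \<epsilon>" for m :: "'p int_array" and \<epsilon>
    proof -
      have "\<forall>x. m x 0 + m x 1 = \<epsilon>" "\<forall>y. m 0 y + m 1 y = \<epsilon>"
        using that by (auto simp: semi_magic_def U)
      from this(1)[rule_format, of 0] this(2)[rule_format, of 0] this(2)[rule_format, of 1]
      show "m 0 1 = \<epsilon> - m 0 0" "m 1 0 = \<epsilon> - m 0 0" "m 1 1 = m 0 0"
        by linarith+
    qed
    show "(\<Sum>x\<in>UNIV. \<Sum>y\<in>UNIV. a (L $ 1 $ 1 * x + L $ 1 $ 2 * y) x * b (L $ 2 $ 1 * x + L $ 2 $ 2 * y) y)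
       = \<gamma> * \<delta>"
      \<comment> \<open>\<open>one_add_one\<close> would compete with \<open>two\<close> for the
        term \<open>1 + 1\<close>.\<close>
      by (simp add: L_def U two eq[OF ab(1)] eq[OF ab(2)] algebra_simps del: one_add_one)
  qed
  ultimately show ?thesis by blast
qed

lemma diagonal_identity_card_3:
  assumes "CARD('p::prime_card) = 3"
  shows "\<exists>L :: 'p mod_ring ^ 2 ^ 2. invertible L \<and> diagonal_identity L"
proof -
  have "2 + 1 = (0 :: 'p mod_ring)"
    using of_nat_card_eq_0[where 'a = 'p] by (simp add: assms)
  \<comment> \<open>Orienting the equation this way keeps all evaluated indices among 0, 1 and
    -1.\<close>
  then have two: "2 = (- 1 :: 'p mod_ring)"
    by (simp only: eq_neg_iff_add_eq_0)
  then have ne: "1 \<noteq> (- 1 :: 'p mod_ring)"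
    by (metis add_cancel_right_right one_add_one one_neq_zero)
  have U: "UNIV = {0, 1, - 1 :: 'p mod_ring}"
    by (rule card_subset_eq[symmetric]) (use assms ne in auto)
  \<comment> \<open>The first column gives \<open>1 - t\<close>, which excludes t = 1; the second
    gives \<open>1 + t\<close>, which excludes t = -1.\<close>
  define L :: "'p mod_ring ^ 2 ^ 2" where "L = vector [vector [1, 1], vector [- 1, 1]]"
  have "invertible L"
    by (simp add: invertible_det_nz det_2 L_def two)
  moreover have "diagonal_identity L"
    unfolding diagonal_identity_def
  proof (intro allI impI)
    fix a b :: "'p int_array" and \<gamma> \<delta>
    assume ab: "semi_magic a \<gamma>" "semi_magic b \<delta>"
    \<comment> \<open>The block with indices 0 and 1 and the line sum determine the other five
      entries.\<close>
    have eq: "m 0 (- 1) = \<epsilon> - m 0 0 - m 0 1" "m 1 (- 1) = \<epsilon> - m 1 0 - m 1 1"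
      "m (- 1) 0 = \<epsilon> - m 0 0 - m 1 0" "m (- 1) 1 = \<epsilon> - m 0 1 - m 1 1"
      "m (- 1) (- 1) = m 0 0 + m 0 1 + m 1 0 + m 1 1 - \<epsilon>"
      if "semi_magic m \<epsilon>" for m :: "'p int_array" and \<epsilon>
    proof -
      have "\<forall>x. m x 0 + m x 1 + m x (- 1) = \<epsilon>" "\<forall>y. m 0 y + m 1 y + m (- 1) y = \<epsilon>"
        using that ne by (auto simp: semi_magic_def U add.assoc)
      from this(1)[rule_format, of 0] this(1)[rule_format, of 1] this(1)[rule_format, of "- 1"]
        this(2)[rule_format, of 0] this(2)[rule_format, of 1]
      show "m 0 (- 1) = \<epsilon> - m 0 0 - m 0 1" "m 1 (- 1) = \<epsilon> - m 1 0 - m 1 1"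
      "m (- 1) 0 = \<epsilon> - m 0 0 - m 1 0" "m (- 1) 1 = \<epsilon> - m 0 1 - m 1 1"
      "m (- 1) (- 1) = m 0 0 + m 0 1 + m 1 0 + m 1 1 - \<epsilon>"
        by linarith+
    qed
    show "(\<Sum>x\<in>UNIV. \<Sum>y\<in>UNIV. a (L $ 1 $ 1 * x + L $ 1 $ 2 * y) x * b (L $ 2 $ 1 * x + L $ 2 $ 2 * y) y)
       = \<gamma> * \<delta>"
      using ne by (simp add: L_def U two eq[OF ab(1)] eq[OF ab(2)]) (simp add: algebra_simps)
  qed
  ultimately show ?thesis by blast
qed

theorem corollary3p8:
  shows "(\<exists>L :: 'p::prime_card mod_ring ^ 2 ^ 2. invertible L \<and>
           (\<forall>(a :: 2 \<Rightarrow> 'p int_array) (\<gamma> :: 2 \<Rightarrow> int).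
              (\<forall>i. semi_magic (a i) (\<gamma> i)) \<longrightarrow>
                (\<Sum>v\<in>UNIV. \<Prod>i\<in>UNIV. a i ((L *v v) $ i) (v $ i)) = \<gamma> 1 * \<gamma> 2 \<and>
                (\<Sum>v\<in>UNIV. \<Prod>i\<in>UNIV. a i ((L *v v) $ i) (reflect (v $ i))) = \<gamma> 1 * \<gamma> 2))
         \<longleftrightarrow> CARD('p) \<le> 3"
  unfolding diagonal_identity_iff
proof
  assume "CARD('p) \<le> 3"
  moreover have "CARD('p) \<ge> 2"
    using prime_card[where 'a = 'p] by (rule prime_ge_2_nat)
  ultimately consider "CARD('p) = 2" | "CARD('p) = 3" by linarith
  then show "\<exists>L :: 'p mod_ring ^ 2 ^ 2. invertible L \<and> diagonal_identity L"
    by cases (use diagonal_identity_card_2 diagonal_identity_card_3 in blast)+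
qed (use diagonal_identity_imp_card_le_3 in blast)

end
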